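(* Let $G$ be a graph of order $n\geq 3$ and let $\overline{G}$ be its complement. Then (1) $$0\leq \mathrm{mp}(G)+\mathrm{mp}(\overline{G})\leq \begin{cases} n-1 & \text{if $n$ is even},\\ 2n-3 & \text{if $n$ is odd};\end{cases}$$ (2) $$0\leq \mathrm{mp}(G)\cdot \mathrm{mp}(\overline{G})\leq \begin{cases} \lceil\frac{n-1}{2}\rceil\lfloor\frac{n-1}{2}\rfloor & \text{if $n$ is even},\\ (n-2)^2 & \text{if $n$ is odd and $n\geq 5$}.\end{cases}$$
   Context: All graphs are finite, simple and undirected; $\overline{G}$ is the complement of $G$. A perfect matching is a set of edges covering every vertex exactly once; an almost-perfect matching is a set of edges covering every vertex except one exactly once and missing the remaining vertex. The matching preclusion number $\mathrm{mp}(G)$ is the minimum number of edges whose deletion leaves a graph with neither a perfect matching nor an almost-perfect matching ($\mathrm{mp}(G)=0$ if $G$ has neither). *)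

theory Defs
  imports Complex_Main "HOL-Library.Ramsey"
begin

(* A graph is given by a vertex set V and a set E of two-element subsets of V. *)
definition simple_graph :: "'a set \<Rightarrow> 'a set set \<Rightarrow> bool" where
  "simple_graph V E \<longleftrightarrow> finite V \<and> E \<subseteq> [V]\<^bsup>2\<^esup>"

definition complement_edges :: "'a set \<Rightarrow> 'a set set \<Rightarrow> 'a set set" where
  "complement_edges V E = [V]\<^bsup>2\<^esup> - E"

definition perfect_matching :: "'a set \<Rightarrow> 'a set set \<Rightarrow> 'a set set \<Rightarrow> bool" where
  "perfect_matching V E M \<longleftrightarrow> M \<subseteq> E \<and> (\<forall>v\<in>V. \<exists>!e. e \<in> M \<and> v \<in> e)"

definition almost_perfect_matching :: "'a set \<Rightarrow> 'a set set \<Rightarrow> 'a set set \<Rightarrow> bool" where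
  "almost_perfect_matching V E M \<longleftrightarrow>
     M \<subseteq> E \<and> (\<exists>u\<in>V. (\<forall>e\<in>M. u \<notin> e) \<and> (\<forall>v\<in>V - {u}. \<exists>!e. e \<in> M \<and> v \<in> e))"

definition matching_precluded :: "'a set \<Rightarrow> 'a set set \<Rightarrow> bool" where
  "matching_precluded V E \<longleftrightarrow>
     (\<nexists>M. perfect_matching V E M) \<and> (\<nexists>M. almost_perfect_matching V E M)"

(* For card V < 2 no edge set is precluding, since the empty matching is (almost) perfect;
   mp is then unspecified.  For card V >= 2 deleting all edges works, so the minimum exists. *)
definition mp :: "'a set \<Rightarrow> 'a set set \<Rightarrow> nat" where
  "mp V E = (LEAST k. \<exists>F. F \<subseteq> E \<and> card F = k \<and> matching_precluded V (E - F))"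

lemma mp_eq_0_if_precluded: "matching_precluded V E \<Longrightarrow> mp V E = 0"
  unfolding mp_def by (rule Least_eq_0) (rule exI[of _ "{}"], simp)

lemma matching_precluded_no_edges:
  assumes "finite V" "card V \<ge> 2"
  shows "matching_precluded V {}"
proof -
  obtain x y where xy: "x \<in> V" "y \<in> V" "x \<noteq> y"
    using assms by (metis One_nat_def card_le_Suc0_iff_eq not_less_eq_eq numeral_2_eq_2)
  then show ?thesis
    by (auto simp: matching_precluded_def perfect_matching_def almost_perfect_matching_def)
qed

lemma mp_attained:
  assumes "simple_graph V E" "card V \<ge> 2"
  shows "\<exists>F. F \<subseteq> E \<and> card F = mp V E \<and> matching_precluded V (E - F)"
  unfolding mp_def
  by (rule LeastI_ex, intro exI[of _ "card E"] exI[of _ E])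
     (use assms matching_precluded_no_edges in \<open>auto simp: simple_graph_def\<close>)

end

theory Submission
  imports Defs
begin

text \<open>
  Deleting all edges at one vertex (if n is even) or at two vertices (if n is odd) precludes
  matchings, and the edges at a fixed vertex, or at a fixed pair, in a graph and in its complement
  add up to the number for the complete graph: n - 1, or 2n - 3. This gives the sums, and AM-GM gives
  the product for even n. For odd n the product could exceed (n - 2)^2 only if the sum were exactly
  2n - 3; then every pair of vertices meets the same number of edges, which for n at least 5
  forces the graph to be complete or empty, so that one of the two factors vanishes.
\<close>

section \<open>Edges at one or two vertices, in a graph and its complement\<close>

definition edges_at :: "'a set set \<Rightarrow> 'a \<Rightarrow> 'a set set" where
  "edges_at E v = {e \<in> E. v \<in> e}"

lemma edges_at_subset: "edges_at E v \<subseteq> E"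
  by (auto simp: edges_at_def)

lemma simple_graph_finite_edges: "simple_graph V E \<Longrightarrow> finite E"
  unfolding simple_graph_def by (meson finite_imp_finite_nsets finite_subset)

lemma simple_graph_complement:
  "simple_graph V E \<Longrightarrow> simple_graph V (complement_edges V E)"
  by (auto simp: simple_graph_def complement_edges_def)

lemma mp_le_card:
  assumes "F \<subseteq> E" "matching_precluded V (E - F)"
  shows "mp V E \<le> card F"
  unfolding mp_def by (rule Least_le) (use assms in blast)

lemma edges_at_complete:
  assumes "v \<in> V"
  shows "edges_at ([V]\<^bsup>2\<^esup>) v = (\<lambda>x. {v, x}) ` (V - {v})"
proof (intro equalityI subsetI)
  fix e assume "e \<in> edges_at ([V]\<^bsup>2\<^esup>) v"
  then have "v \<in> e" "e \<subseteq> V" "card e = 2"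
    by (auto simp: edges_at_def nsets_def)
  moreover from this obtain x where "e = {v, x}" "x \<noteq> v"
    by (metis card_2_iff insertE insert_commute singletonD)
  ultimately show "e \<in> (\<lambda>x. {v, x}) ` (V - {v})" by auto
qed (use assms in \<open>auto simp: edges_at_def nsets_def card_insert_if\<close>)

lemma card_edges_at_complete:
  assumes "v \<in> V" "finite V"
  shows "card (edges_at ([V]\<^bsup>2\<^esup>) v) = card V - 1"
proof -
  have "inj_on (\<lambda>x. {v, x}) (V - {v})" by (auto simp: inj_on_def doubleton_eq_iff)
  then show ?thesis
    using assms by (simp add: edges_at_complete card_image)
qed

lemma card_edges_at_complement:
  assumes "simple_graph V E" "v \<in> V"
  shows "card (edges_at E v) + card (edges_at (complement_edges V E) v) = card V - 1"
proof -
  have "edges_at ([V]\<^bsup>2\<^esup>) v = edges_at E v \<union> edges_at (complement_edges V E) v"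
    and "edges_at E v \<inter> edges_at (complement_edges V E) v = {}"
    using assms(1) by (auto simp: edges_at_def complement_edges_def simple_graph_def)
  moreover have "finite (edges_at E v)" "finite (edges_at (complement_edges V E) v)"
    using assms(1) simple_graph_complement simple_graph_finite_edges edges_at_subset
    by (meson finite_subset)+
  ultimately show ?thesis
    using assms card_edges_at_complete[of v V]
    by (simp add: card_Un_disjoint simple_graph_def)
qed

text \<open>Inclusion-exclusion: by simplicity, the only edge that can contain both \<open>u\<close>
  and \<open>v\<close> is \<open>{u, v}\<close>. The correction stands on the left to avoid
  truncated subtraction.\<close>

lemma card_edges_at_Un:
  assumes "simple_graph V E" "u \<noteq> v"
  shows "card (edges_at E u \<union> edges_at E v) + of_bool ({u, v} \<in> E)
           = card (edges_at E u) + card (edges_at E v)"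
proof -
  have fin: "finite (edges_at E u)" "finite (edges_at E v)"
    using assms(1) simple_graph_finite_edges edges_at_subset by (meson finite_subset)+
  have "e = {u, v}" if "e \<in> E" "u \<in> e" "v \<in> e" for e
  proof -
    have "finite e" "card e = 2"
      using that assms(1) by (auto simp: simple_graph_def nsets_def)
    then show ?thesis
      using that assms(2) by (metis card_2_iff insertE insert_commute singletonD)
  qed
  then have "edges_at E u \<inter> edges_at E v = E \<inter> {{u, v}}"
    unfolding edges_at_def by blast
  then have "card (edges_at E u \<inter> edges_at E v) = of_bool ({u, v} \<in> E)"
    by (cases "{u, v} \<in> E") simp_all
  then show ?thesis using card_Un_Int[OF fin] by simp
qed

text \<open>The degrees in the two graphs total \<open>n - 1\<close> at each of \<open>u\<close> and
  \<open>v\<close>, hence \<open>2 * n - 2\<close>; the pair \<open>{u, v}\<close> is an edge of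
  exactly one of the graphs, so exactly one edge is counted twice.\<close>

lemma card_edges_at_Un_complement:
  assumes "simple_graph V E" "u \<in> V" "v \<in> V" "u \<noteq> v"
  shows "card (edges_at E u \<union> edges_at E v)
         + card (edges_at (complement_edges V E) u \<union> edges_at (complement_edges V E) v)
           = 2 * card V - 3"
proof -
  have "({u, v} \<in> complement_edges V E) \<longleftrightarrow> {u, v} \<notin> E"
    using assms by (auto simp: complement_edges_def nsets_def)
  then show ?thesis
    using card_edges_at_Un[OF assms(1,4)]
      card_edges_at_Un[OF simple_graph_complement[OF assms(1)] assms(4)]
      card_edges_at_complement[OF assms(1,2)] card_edges_at_complement[OF assms(1,3)]
    by (cases "{u, v} \<in> E") auto
qed

section \<open>Bounding mp by isolating vertices\<close>

lemma odd_card_if_almost_perfect_matching: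
  assumes "simple_graph V E" "almost_perfect_matching V E M"
  shows "odd (card V)"
proof -
  obtain u where ME: "M \<subseteq> E" and u: "u \<in> V" "\<forall>e\<in>M. u \<notin> e"
    and cover: "\<forall>v\<in>V - {u}. \<exists>!e. e \<in> M \<and> v \<in> e"
    using assms(2) by (auto simp: almost_perfect_matching_def)
  have M: "e \<subseteq> V - {u} \<and> card e = 2" if "e \<in> M" for e
    using that ME u assms(1) by (auto simp: simple_graph_def nsets_def)
  have fin: "finite V" using assms(1) by (simp add: simple_graph_def)
  have un: "\<Union>M = V - {u}"
  proof
    show "\<Union>M \<subseteq> V - {u}" using M by blast
    show "V - {u} \<subseteq> \<Union>M" using cover by (meson UnionI subsetI)
  qed
  \<comment> \<open>The edges of \<open>M\<close> partition the covered vertices into blocks of size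
    2.\<close>
  have "2 * card M = card (\<Union>M)"
  proof (rule card_partition)
    show "finite M" using ME simple_graph_finite_edges[OF assms(1)] by (rule finite_subset)
    show "finite (\<Union>M)" using un fin by simp
    show "card c = 2" if "c \<in> M" for c using M[OF that] by blast
    show "c1 \<inter> c2 = {}" if "c1 \<in> M" "c2 \<in> M" "c1 \<noteq> c2" for c1 c2
    proof (rule ccontr)
      assume "c1 \<inter> c2 \<noteq> {}"
      then obtain x where x: "x \<in> c1" "x \<in> c2" by blast
      then have "\<exists>!e. e \<in> M \<and> x \<in> e" using cover un that(1) by blast
      then show False using that x by metis
    qed
  qed
  also have "\<dots> = card V - 1" using un u(1) by simp
  finally have "2 * card M = card V - 1" .
  \<comment> \<open>Excludes the truncated case \<open>0 - 1 = 0\<close>, in which the parity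
    argument would fail.\<close>
  moreover have "card V > 0" using u(1) fin by (auto simp: card_gt_0_iff)
  ultimately show ?thesis by presburger
qed

text \<open>Isolating \<open>v\<close> rules out perfect matchings; almost-perfect ones are already
  excluded by parity.\<close>

lemma mp_le_edges_at:
  assumes "simple_graph V E" "even (card V)" "v \<in> V"
  shows "mp V E \<le> card (edges_at E v)"
proof (rule mp_le_card[OF edges_at_subset])
  have "simple_graph V (E - edges_at E v)"
    using assms(1) by (auto simp: simple_graph_def)
  then have "\<nexists>M. almost_perfect_matching V (E - edges_at E v) M"
    using odd_card_if_almost_perfect_matching assms(2) by blast
  moreover have "\<not> perfect_matching V (E - edges_at E v) M" for M
  proof
    assume "perfect_matching V (E - edges_at E v) M"
    then obtain e where "e \<in> M" "v \<in> e" "M \<subseteq> E - edges_at E v"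
      using assms(3) unfolding perfect_matching_def by metis
    then show False by (auto simp: edges_at_def)
  qed
  ultimately show "matching_precluded V (E - edges_at E v)"
    by (simp add: matching_precluded_def)
qed

text \<open>With both \<open>u\<close> and \<open>v\<close> isolated, a matching misses at least two
  vertices, whereas an almost-perfect one misses only one.\<close>

lemma mp_le_edges_at_Un:
  assumes "u \<in> V" "v \<in> V" "u \<noteq> v"
  shows "mp V E \<le> card (edges_at E u \<union> edges_at E v)"
proof (rule mp_le_card)
  show "edges_at E u \<union> edges_at E v \<subseteq> E" by (simp add: edges_at_subset)
  show "matching_precluded V (E - (edges_at E u \<union> edges_at E v))"
    (is "matching_precluded V ?E'")
  proof -
    have isolated: "w \<notin> e" if "M \<subseteq> ?E'" "e \<in> M" "w \<in> {u, v}" for M e w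
      using that by (auto simp: edges_at_def)
    have "\<not> perfect_matching V ?E' M" for M
      unfolding perfect_matching_def using isolated assms(1) by (metis insertI1)
    moreover have "\<not> almost_perfect_matching V ?E' M" for M
    proof
      assume "almost_perfect_matching V ?E' M"
      then obtain x where M: "M \<subseteq> ?E'" and x: "\<forall>w\<in>V - {x}. \<exists>!e. e \<in> M \<and> w \<in> e"
        unfolding almost_perfect_matching_def by blast
      obtain w where "w \<in> {u, v}" "w \<in> V - {x}" using assms by blast
      then show False using x isolated[OF M] by metis
    qed
    ultimately show ?thesis by (simp add: matching_precluded_def)
  qed
qed

lemma mp_no_edges: "finite V \<Longrightarrow> card V \<ge> 2 \<Longrightarrow> mp V {} = 0"
  by (simp add: mp_eq_0_if_precluded matching_precluded_no_edges)

section \<open>Graphs in which all pairs of vertices meet equally many edges\<close>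

lemma obtain_fresh_three:
  assumes "finite V" "card V \<ge> 5"
  obtains x y z where "x \<in> V - {u, v}" "y \<in> V - {u, v}" "z \<in> V - {u, v}"
    "x \<noteq> y" "x \<noteq> z" "y \<noteq> z"
proof -
  have "card (V - {u, v}) \<ge> card V - card {u, v}"
    by (rule diff_card_le_card_Diff) simp
  moreover have "card {u, v} \<le> 2" by (simp add: card_insert_if)
  ultimately have "3 \<le> card (V - {u, v})" using assms(2) by linarith
  then obtain T where "T \<subseteq> V - {u, v}" "card T = 3"
    by (rule obtain_subset_with_card_n)
  then show ?thesis using that by (auto simp: card_3_iff)
qed

text \<open>Uniformity forces all degrees to agree; then any two vertices have the same neighbours
  among the remaining ones, so a single edge can be moved onto every pair.\<close>

lemma complete_or_empty_if_pairs_uniform: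
  assumes G: "simple_graph V E" and n: "card V \<ge> 5"
    and unif: "\<And>u v. u \<in> V \<Longrightarrow> v \<in> V \<Longrightarrow> u \<noteq> v \<Longrightarrow> card (edges_at E u \<union> edges_at E v) = k"
  shows "E = {} \<or> complement_edges V E = {}"
proof -
  let ?d = "\<lambda>v. card (edges_at E v)"
  have fin: "finite V" using G by (simp add: simple_graph_def)
  \<comment> \<open>Compare the counts for \<open>{u, w}\<close> and \<open>{v, w}\<close>: both
    unions have size \<open>k\<close>, and the degree of \<open>w\<close> cancels.\<close>
  have exch: "?d u + of_bool ({v, w} \<in> E) = ?d v + of_bool ({u, w} \<in> E)"
    if "u \<in> V" "v \<in> V" "w \<in> V" "u \<noteq> w" "v \<noteq> w" for u v w
    using card_edges_at_Un[OF G that(4)] card_edges_at_Un[OF G that(5)]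
      unif[OF that(1,3,4)] unif[OF that(2,3,5)] by linarith
  have le: "?d u \<le> ?d v" if uv: "u \<in> V" "v \<in> V" for u v
  proof (rule ccontr)
    assume less: "\<not> ?d u \<le> ?d v"
    \<comment> \<open>In \<open>exch\<close> the degrees differ by a difference of two indicators,
      so a strictly larger degree at \<open>u\<close> leaves only this pattern.\<close>
    have sep: "{u, w} \<in> E \<and> {v, w} \<notin> E \<and> ?d u = ?d v + 1" if "w \<in> V - {u, v}" for w
      using exch[of u v w] that uv less
      by (cases "{u, w} \<in> E"; cases "{v, w} \<in> E") auto
    \<comment> \<open>Three further vertices give \<open>u\<close> degree at least 3, while
      \<open>v\<close> can be joined only to \<open>u\<close>; this contradicts the degree
      difference of 1 in \<open>sep\<close>.\<close>
    obtain x y z where xyz: "x \<in> V - {u, v}" "y \<in> V - {u, v}" "z \<in> V - {u, v}"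
      "x \<noteq> y" "x \<noteq> z" "y \<noteq> z"
      using obtain_fresh_three[OF fin n] by metis
    have "{{u, x}, {u, y}, {u, z}} \<subseteq> edges_at E u"
      using sep xyz by (auto simp: edges_at_def)
    moreover have "card {{u, x}, {u, y}, {u, z}} = 3"
      using xyz by (auto simp: card_insert_if doubleton_eq_iff)
    moreover have "finite (edges_at E u)"
      using G simple_graph_finite_edges edges_at_subset by (meson finite_subset)
    ultimately have "3 \<le> ?d u" by (metis card_mono)
    have "edges_at E v \<subseteq> edges_at ([V]\<^bsup>2\<^esup>) v"
      using G by (auto simp: edges_at_def simple_graph_def)
    also have "\<dots> = (\<lambda>x. {v, x}) ` (V - {v})" by (rule edges_at_complete[OF uv(2)])
    finally have "edges_at E v \<subseteq> {{v, u}}"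
      using sep by (auto simp: edges_at_def)
    then have "?d v \<le> 1" using card_mono[of "{{v, u}}"] by fastforce
    then show False using \<open>3 \<le> ?d u\<close> sep[OF xyz(1)] by linarith
  qed
  have twins: "{u, w} \<in> E \<longleftrightarrow> {v, w} \<in> E"
    if "u \<in> V" "v \<in> V" "w \<in> V" "u \<noteq> w" "v \<noteq> w" for u v w
  proof -
    have "?d u = ?d v" using le that by (meson le_antisym)
    then show ?thesis using exch[OF that] by (auto simp: of_bool_def split: if_splits)
  qed
  have "f \<in> E" if ef: "e \<in> E" "f \<in> [V]\<^bsup>2\<^esup>" for e f
  proof -
    have "e \<in> [V]\<^bsup>2\<^esup>" using G ef(1) by (auto simp: simple_graph_def)
    then obtain a b where ab: "e = {a, b}" "a \<in> V" "b \<in> V" "a \<noteq> b"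
      by (auto simp: nsets_def card_2_iff)
    obtain c d where cd: "f = {c, d}" "c \<in> V" "d \<in> V" "c \<noteq> d"
      using ef(2) by (auto simp: nsets_def card_2_iff)
    \<comment> \<open>Move one endpoint at a time, \<open>{a, b}\<close> to \<open>{c, b}\<close> to
      \<open>{c, d}\<close>. If \<open>c = b\<close>, the middle pair would degenerate, and
      replacing \<open>a\<close> by \<open>d\<close> is enough.\<close>
    show ?thesis
    proof (cases "c = b")
      case True
      then show ?thesis
        using twins[of a d b] ef(1) ab cd by (auto simp: insert_commute)
    next
      case False
      then show ?thesis
        using twins[of a c b] twins[of b d c] ef(1) ab cd by (auto simp: insert_commute)
    qed
  qed
  then show ?thesis by (auto simp: complement_edges_def)
qed

section \<open>Bounds on the product\<close>

lemma mp_product_le_odd: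
  assumes G: "simple_graph V E" and n: "card V \<ge> 5"
  shows "mp V E * mp V (complement_edges V E) \<le> (card V - 2)\<^sup>2"
proof (cases "mp V E + mp V (complement_edges V E) \<le> 2 * (card V - 2)")
  case True
  \<comment> \<open>AM-GM via \<open>4ab = (a + b)^2 - (a - b)^2\<close>, over the integers so that
    \<open>a - b\<close> is not truncated.\<close>
  let ?a = "int (mp V E)" and ?b = "int (mp V (complement_edges V E))" and ?m = "int (card V - 2)"
  have "?a + ?b \<le> 2 * ?m" using True by linarith
  then have "(?a + ?b)\<^sup>2 \<le> (2 * ?m)\<^sup>2" by (intro power_mono) auto
  moreover have "0 \<le> (?a - ?b)\<^sup>2" by simp
  ultimately have "?a * ?b \<le> ?m\<^sup>2" by (simp add: power2_eq_square algebra_simps)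
  then show ?thesis by (metis of_nat_le_iff of_nat_mult of_nat_power)
next
  case False
  \<comment> \<open>The sum is now at least \<open>2 * n - 3\<close>, which is also the total of the
    two upper bounds given by any pair. Both bounds are therefore attained, with a value independent
    of the pair.\<close>
  have "card (edges_at E u \<union> edges_at E v) = mp V E" if "u \<in> V" "v \<in> V" "u \<noteq> v" for u v
    using card_edges_at_Un_complement[OF G that] mp_le_edges_at_Un[OF that, of E]
      mp_le_edges_at_Un[OF that, of "complement_edges V E"] False n by linarith
  then have "E = {} \<or> complement_edges V E = {}"
    by (rule complete_or_empty_if_pairs_uniform[OF G n])
  moreover have "mp V {} = 0"
    using G n by (intro mp_no_edges) (auto simp: simple_graph_def)
  ultimately show ?thesis by auto
qed

text \<open>Integer AM-GM for an odd bound on the sum: \<open>m(m - 1) - a(2m - 1 - a)\<close>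
  factors as \<open>(m - a)(m - 1 - a)\<close>, a product of two consecutive integers and hence
  nonnegative.\<close>

lemma mult_le_if_add_le_odd:
  fixes a b m :: int
  assumes "a + b \<le> 2 * m - 1" "0 \<le> a" "0 \<le> b"
  shows "a * b \<le> m * (m - 1)"
proof -
  have "a * b \<le> a * (2 * m - 1 - a)" using assms by (intro mult_left_mono) auto
  moreover have "0 \<le> (m - a) * (m - 1 - a)"
    by (cases "a \<le> m - 1") (auto intro: mult_nonneg_nonneg mult_nonpos_nonpos)
  ultimately show ?thesis by (simp add: algebra_simps)
qed

theorem theorem5p1:
  fixes V :: "'a set" and E :: "'a set set" and n :: nat
  assumes "simple_graph V E" and "card V = n" and "n \<ge> 3"
  shows "(0 \<le> mp V E + mp V (complement_edges V E) \<and>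
          mp V E + mp V (complement_edges V E) \<le> (if even n then n - 1 else 2 * n - 3)) \<and>
         (0 \<le> mp V E * mp V (complement_edges V E) \<and>
          (even n \<longrightarrow> int (mp V E * mp V (complement_edges V E))
             \<le> \<lceil>(real n - 1) / 2\<rceil> * \<lfloor>(real n - 1) / 2\<rfloor>) \<and>
          (odd n \<and> n \<ge> 5 \<longrightarrow> mp V E * mp V (complement_edges V E) \<le> (n - 2)\<^sup>2))"
proof -
  let ?E' = "complement_edges V E"
  have "finite V" "\<not> card V \<le> Suc 0"
    using assms by (auto simp: simple_graph_def)
  then obtain u v where uv: "u \<in> V" "v \<in> V" "u \<noteq> v"
    by (auto simp: card_le_Suc0_iff_eq)
  have even_sum: "mp V E + mp V ?E' \<le> n - 1" if "even n"
    using mp_le_edges_at[OF assms(1) _ uv(1)] card_edges_at_complement[OF assms(1) uv(1)]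
      mp_le_edges_at[OF simple_graph_complement[OF assms(1)] _ uv(1)] assms(2) that by force
  have odd_sum: "mp V E + mp V ?E' \<le> 2 * n - 3"
    using mp_le_edges_at_Un[OF uv, of E] mp_le_edges_at_Un[OF uv, of ?E']
      card_edges_at_Un_complement[OF assms(1) uv] assms(2) by linarith
  have "int (mp V E * mp V ?E') \<le> \<lceil>(real n - 1) / 2\<rceil> * \<lfloor>(real n - 1) / 2\<rfloor>" if "even n"
  proof -
    obtain m where m: "n = 2 * m" using \<open>even n\<close> by (elim evenE)
    \<comment> \<open>Here \<open>(n - 1) / 2\<close> is the half-integer \<open>m - 1/2\<close>, so
      the two roundings are the factors \<open>m\<close> and \<open>m - 1\<close> of the integer
      AM-GM bound.\<close>
    have "\<lceil>(real n - 1) / 2\<rceil> = int m" "\<lfloor>(real n - 1) / 2\<rfloor> = int m - 1"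
      using m by (simp_all add: ceiling_eq_iff floor_eq_iff)
    moreover have "int (mp V E) + int (mp V ?E') \<le> 2 * int m - 1"
      using even_sum[OF that] m assms(3) by linarith
    ultimately show ?thesis
      using mult_le_if_add_le_odd[of "int (mp V E)" "int (mp V ?E')" "int m"] by simp
  qed
  then show ?thesis
    using even_sum odd_sum mp_product_le_odd[OF assms(1)] assms(2) by auto
qed

end
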